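(* Let $\omega,\pi:[0,a]\to[0,b]$ be continuous non-increasing functions with $\pi(x)\le\omega(x)$ for all $x\in[0,a]$, and suppose that $\operatorname{area}(\omega/\pi)=1$. Let $\{\upsilon_n=\lambda^{(n)}/\mu^{(n)}\}$ be a sequence of connected skew shapes with stable shape $\omega/\pi$, i.e. $\lambda^{(n)}\to\omega$ and $\mu^{(n)}\to\pi$. Then $$\log e(\upsilon_n)\ \sim\ \frac12\,n\log n\qquad\text{as } n\to\infty.$$
   Context: $e(\lambda/\mu)$ is the number of standard Young tableaux of skew shape $\lambda/\mu$; $\log$ is the natural logarithm; $\sim$ means that the ratio tends to $1$. $\operatorname{area}(\omega/\pi)$ is the area of the region $\mathcal{C}=\{(x,y):0\le x\le a,\ \pi(x)\le y\le\omega(x)\}$. Stable shape: for a partition $\lambda$, let $[\lambda]$ denote the boundary curve of its Young diagram, viewed as the function $[\lambda](x)=\lambda_{\lceil x\rceil}$ for $x>0$ and $[\lambda](0)=\lambda_1$ (with $\lambda_i=0$ for $i$ greater than the number of parts $\ell(\lambda)$). The rescaled diagram $\frac{1}{\sqrt n}[\lambda]$ is obtained by contracting by a factor $1/\sqrt n$ in both directions, i.e. it is the function $x\mapsto\frac{1}{\sqrt n}[\lambda](x\sqrt n)$. A sequence of partitions $\{\lambda^{(n)}\}$ has stable shape $\omega$, written $\lambda^{(n)}\to\omega$, if the rescaled diagrams $\frac{1}{\sqrt n}[\lambda^{(n)}]$ converge uniformly to $\omega$ on $[0,a]$ as $n\to\infty$, and the rescaled diagrams do not asymptotically extend beyond $x=a$,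 i.e. $\ell(\lambda^{(n)})\le(a+o(1))\sqrt n$. *)

theory Defs
  imports "HOL-Analysis.Analysis" "HOL-Library.Landau_Symbols"
begin

definition is_partition :: "nat list \<Rightarrow> bool" where
  "is_partition p \<longleftrightarrow> sorted_wrt (\<ge>) p \<and> 0 \<notin> set p"

definition part :: "nat list \<Rightarrow> nat \<Rightarrow> nat" where
  "part p i = (if 1 \<le> i \<and> i \<le> length p then p ! (i - 1) else 0)"

definition is_skew_shape :: "nat list \<Rightarrow> nat list \<Rightarrow> bool" where
  "is_skew_shape p q \<longleftrightarrow> is_partition p \<and> is_partition q \<and> (\<forall>i. part q i \<le> part p i)"

definition skew_diagram :: "nat list \<Rightarrow> nat list \<Rightarrow> (nat \<times> nat) set" where
  "skew_diagram p q = {(i, j). 1 \<le> i \<and> part q i < j \<and> j \<le> part p i}"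

text \<open>Two cells are adjacent if they share an edge; sharing only a corner does not count.\<close>

definition cell_adjacent :: "nat \<times> nat \<Rightarrow> nat \<times> nat \<Rightarrow> bool" where
  "cell_adjacent c d \<longleftrightarrow>
     fst c = fst d \<and> (snd d = Suc (snd c) \<or> snd c = Suc (snd d)) \<or>
     snd c = snd d \<and> (fst d = Suc (fst c) \<or> fst c = Suc (fst d))"

definition cells_connected :: "(nat \<times> nat) set \<Rightarrow> bool" where
  "cells_connected D \<longleftrightarrow>
     (\<forall>c\<in>D. \<forall>d\<in>D. (c, d) \<in> {(u, v). u \<in> D \<and> v \<in> D \<and> cell_adjacent u v}\<^sup>*)"

definition connected_skew_shape :: "nat list \<Rightarrow> nat list \<Rightarrow> bool" where
  "connected_skew_shape p q \<longleftrightarrow> is_skew_shape p q \<and> cells_connected (skew_diagram p q)"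

text \<open>Fillings are taken to be \<^const>\<open>undefined\<close> outside the diagram, so that each
  tableau is counted once.\<close>

definition standard_tableaux :: "(nat \<times> nat) set \<Rightarrow> (nat \<times> nat \<Rightarrow> nat) set" where
  "standard_tableaux D = {T \<in> extensional D.
     bij_betw T D {1..card D} \<and>
     (\<forall>i j j'. (i, j) \<in> D \<and> (i, j') \<in> D \<and> j < j' \<longrightarrow> T (i, j) < T (i, j')) \<and>
     (\<forall>i i' j. (i, j) \<in> D \<and> (i', j) \<in> D \<and> i < i' \<longrightarrow> T (i, j) < T (i', j))}"

definition num_SYT :: "nat list \<Rightarrow> nat list \<Rightarrow> nat" where
  "num_SYT p q = card (standard_tableaux (skew_diagram p q))"

definition boundary :: "nat list \<Rightarrow> real \<Rightarrow> real" where
  "boundary p x = (if x = 0 then real (part p 1) else real (part p (nat \<lceil>x\<rceil>)))"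

definition rescaled :: "nat \<Rightarrow> nat list \<Rightarrow> real \<Rightarrow> real" where
  "rescaled n p x = (1 / sqrt (real n)) * boundary p (x * sqrt (real n))"

definition stable_shape :: "real \<Rightarrow> (nat \<Rightarrow> nat list) \<Rightarrow> (real \<Rightarrow> real) \<Rightarrow> bool" where
  "stable_shape a p \<omega> \<longleftrightarrow>
     uniform_limit {0..a} (\<lambda>n. rescaled n (p n)) \<omega> sequentially \<and>
     (\<exists>\<epsilon>. \<epsilon> \<longlonglongrightarrow> 0 \<and>
        (\<forall>\<^sub>F n in sequentially. real (length (p n)) \<le> (a + \<epsilon> n) * sqrt (real n)))"

definition skew_area :: "real \<Rightarrow> (real \<Rightarrow> real) \<Rightarrow> (real \<Rightarrow> real) \<Rightarrow> real" where
  "skew_area a \<omega> \<pi> =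
     measure lborel {(x, y). 0 \<le> x \<and> x \<le> a \<and> \<pi> x \<le> y \<and> y \<le> \<omega> x}"

end

(*
  A tableau is determined by the list of rows in which 1, 2, ..., N lie, so there are at most
  l^N tableaux of a shape with N cells in l rows. Conversely the antidiagonals i + j = s can be
  filled one after the other, each in arbitrary order; as a! >= c^a / e^c for every c > 0, this
  gives at least c^N / e^(m c) tableaux, m being the number of antidiagonals. A stable shape
  has l, m = O(sqrt n), and N ~ n because the area is the limit of Riemann sums, so taking
  c = sqrt n both bounds have logarithm (1/2) n log n + O(n) + o(n log n).
*)

theory Submission
  imports Defs "HOL-Real_Asymp.Real_Asymp"
begin

section \<open>Lower bound: fillings level by level\<close>

lemma card_extensional_bij_betw:
  assumes "finite A" "finite B" "card A = card B"
  shows "card {f \<in> extensional A. bij_betw f A B} = fact (card A)"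
proof -
  have "{f \<in> extensional A. bij_betw f A B} = {f \<in> A \<rightarrow>\<^sub>E B. inj_on f A}"
  proof -
    have "f ` A = B" if "f \<in> A \<rightarrow>\<^sub>E B" "inj_on f A" for f
      using that assms by (intro card_subset_eq) (auto simp: card_image)
    then show ?thesis
      by (auto simp: bij_betw_def PiE_def)
  qed
  then show ?thesis
    using card_inj_on_subset_funcset[OF assms(1,2) order_refl] assms(3)
    by (simp add: fact_prod_rev)
qed

text \<open>A single term of the exponential series is at most its sum. Used as a lower bound on
  \<open>fact n\<close> in which \<open>c\<close> can still be chosen.\<close>

lemma power_le_exp_mult_fact:
  fixes c :: real
  assumes "0 \<le> c"
  shows "c ^ n \<le> exp c * fact n"
proof -
  have "(\<Sum>i\<in>{n}. c ^ i /\<^sub>R fact i) \<le> exp c"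
    unfolding exp_def using assms by (intro sum_le_suminf summable_exp_generic) auto
  then show ?thesis
    by (simp add: field_simps)
qed

text \<open>Inside a level of \<open>r\<close> the order is free. The shape plays no part here; the
  rank of a cell \<open>(i, j)\<close> will be \<open>i + j\<close>.\<close>

definition level_fillings :: "'a set \<Rightarrow> ('a \<Rightarrow> nat) \<Rightarrow> ('a \<Rightarrow> nat) set" where
  "level_fillings D r = {T \<in> extensional D. bij_betw T D {1..card D} \<and>
     (\<forall>x\<in>D. \<forall>y\<in>D. r x < r y \<longrightarrow> T x < T y)}"

lemma finite_extensional_bij_betw:
  assumes "finite A" "finite B"
  shows "finite {f \<in> extensional A. bij_betw f A B \<and> P f}"
  by (rule finite_subset[OF _ finite_PiE[OF assms(1), of "\<lambda>_. B"]])
    (use assms in \<open>auto simp: bij_betw_def PiE_def\<close>)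

text \<open>A filling of the levels below \<open>m\<close> uses the values up to
  \<open>card D'\<close>. Gluing it with any bijection from the top level \<open>L\<close> onto the
  remaining values gives a filling of \<open>D\<close>, and both pieces can be read off the
  result.\<close>

lemma level_fillings_extend:
  fixes D :: "'a set" and r :: "'a \<Rightarrow> nat" and m :: nat
  defines "D' \<equiv> {x \<in> D. r x < m}" and "L \<equiv> {x \<in> D. r x = m}"
  assumes fin: "finite D" and le: "\<And>x. x \<in> D \<Longrightarrow> r x < Suc m"
  shows "fact (card L) * card (level_fillings D' r) \<le> card (level_fillings D r)"
proof -
  define I where "I = {card D' <.. card D}"
  define B where "B = {f \<in> extensional L. bij_betw f L I}"
  \<comment> \<open>Off \<open>D\<close> the second branch returns \<open>undefined\<close>, as
    \<open>f\<close> is extensional on \<open>L\<close>; so the glued function is extensional on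
    \<open>D\<close>.\<close>
  define F where "F = (\<lambda>(T, f) x. if x \<in> D' then (T x :: nat) else f x)"
  have D: "D = D' \<union> L" "D' \<inter> L = {}"
    using le by (auto simp: D'_def L_def less_Suc_eq)
  have finDL: "finite D'" "finite L"
    using fin by (auto simp: D'_def L_def)
  have card_D: "card D = card D' + card L"
    using finDL D by (simp add: card_Un_disjoint)
  have card_B: "card B = fact (card L)"
    unfolding B_def using finDL card_D by (intro card_extensional_bij_betw) (auto simp: I_def)
  have "card (level_fillings D' r \<times> B) \<le> card (level_fillings D r)"
  proof (rule card_inj_on_le)
    show "inj_on F (level_fillings D' r \<times> B)"
    proof (rule inj_onI, clarify)
      fix T f T' f'
      assume T: "T \<in> level_fillings D' r" "T' \<in> level_fillings D' r" and f: "f \<in> B" "f' \<in> B"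
        and eq: "F (T, f) = F (T', f')"
      have "T x = T' x" for x
        using fun_cong[OF eq, of x] T
        by (cases "x \<in> D'") (auto simp: F_def level_fillings_def extensional_def)
      moreover have "f x = f' x" for x
        using fun_cong[OF eq, of x] f D
        by (cases "x \<in> L") (auto simp: F_def B_def extensional_def split: if_splits)
      ultimately show "T = T' \<and> f = f'"
        by auto
    qed
    show "F ` (level_fillings D' r \<times> B) \<subseteq> level_fillings D r"
    proof clarify
      fix T f
      assume T: "T \<in> level_fillings D' r" and f: "f \<in> B"
      have "bij_betw (F (T, f)) D' {1..card D'}"
        using T by (auto simp: F_def level_fillings_def cong: bij_betw_cong)
      moreover have "bij_betw (F (T, f)) L I"
      proof -
        have "bij_betw (F (T, f)) L I = bij_betw f L I"
          using D(2) by (intro bij_betw_cong) (auto simp: F_def)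
        then show ?thesis using f by (simp add: B_def)
      qed
      ultimately have "bij_betw (F (T, f)) (D' \<union> L) ({1..card D'} \<union> I)"
        by (rule bij_betw_combine) (auto simp: I_def)
      also have "{1..card D'} \<union> I = {1..card D}"
        using card_D by (auto simp: I_def)
      finally have bij: "bij_betw (F (T, f)) D {1..card D}"
        using D by simp
      have ext: "F (T, f) \<in> extensional D"
        using T f D by (auto simp: F_def level_fillings_def B_def extensional_def)
      have "F (T, f) x < F (T, f) y" if "x \<in> D" "y \<in> D" "r x < r y" for x y
      proof -
        \<comment> \<open>\<open>x\<close> lies strictly below the level of \<open>y\<close>, hence
          below the top one; only the position of \<open>y\<close> needs a case distinction.\<close>
        have x: "x \<in> D'" using that le[of y] by (auto simp: D'_def)
        show ?thesis
        proof (cases "y \<in> D'")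
          case True
          then show ?thesis using x T that by (auto simp: F_def level_fillings_def)
        next
          case False
          then have "y \<in> L" using D that by auto
          then have "f y \<in> I" using f by (auto simp: B_def bij_betw_def)
          moreover have "T x \<in> {1..card D'}"
            using x T by (auto simp: level_fillings_def bij_betw_def)
          ultimately show ?thesis using x False by (auto simp: F_def I_def)
        qed
      qed
      with bij ext show "F (T, f) \<in> level_fillings D r"
        by (auto simp: level_fillings_def)
    qed
    show "finite (level_fillings D r)"
      unfolding level_fillings_def using fin by (intro finite_extensional_bij_betw) auto
  qed
  then show ?thesis
    by (simp add: card_cartesian_product card_B mult.commute)
qed

text \<open>Each of the \<open>m\<close> levels contributes at least
  \<open>c ^ card L / exp c\<close> choices, and the exponents add up to \<open>card D\<close>. An
  empty level is covered too, since 1 \<le> \<open>exp c\<close>.\<close>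

lemma card_level_fillings_ge:
  fixes c :: real
  assumes "finite D" "0 < c" "\<And>x. x \<in> D \<Longrightarrow> r x < m"
  shows "c ^ card D \<le> exp c ^ m * real (card (level_fillings D r))"
  using assms(1,3)
proof (induction m arbitrary: D)
  case 0
  then have "D = {}" by auto
  then have "level_fillings D r = {\<lambda>_. undefined}"
    by (auto simp: level_fillings_def bij_betw_def)
  then show ?case using \<open>D = {}\<close> by simp
next
  case (Suc m)
  define D' where "D' = {x \<in> D. r x < m}"
  define L where "L = {x \<in> D. r x = m}"
  have "card D = card D' + card L"
  proof -
    have "D = D' \<union> L" "D' \<inter> L = {}"
      using Suc.prems by (auto simp: D'_def L_def less_Suc_eq)
    then show ?thesis using Suc.prems(1) by (metis card_Un_disjoint finite_Un)
  qed
  then have "c ^ card D = c ^ card L * c ^ card D'"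
    by (simp add: power_add mult.commute)
  also have "\<dots> \<le> (exp c * fact (card L)) * (exp c ^ m * real (card (level_fillings D' r)))"
  proof (intro mult_mono)
    show "c ^ card D' \<le> exp c ^ m * real (card (level_fillings D' r))"
      using Suc.prems(1) by (intro Suc.IH) (auto simp: D'_def)
  qed (use assms(2) in \<open>auto intro!: power_le_exp_mult_fact\<close>)
  also have "\<dots> = exp c ^ Suc m * real (fact (card L) * card (level_fillings D' r))"
    by simp
  also have "\<dots> \<le> exp c ^ Suc m * real (card (level_fillings D r))"
    using level_fillings_extend[OF Suc.prems(1), of r m] Suc.prems(2)
    by (intro mult_left_mono) (auto simp: D'_def L_def simp flip: of_nat_mult)
  finally show ?case .
qed

lemma finite_standard_tableaux: "finite D \<Longrightarrow> finite (standard_tableaux D)"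
  unfolding standard_tableaux_def by (rule finite_extensional_bij_betw) auto

text \<open>The rank \<open>i + j\<close> increases strictly along rows and down columns, so every
  level filling for it is a standard tableau.\<close>

lemma card_standard_tableaux_ge:
  fixes c :: real
  assumes "finite D" "0 < c" "\<And>i j. (i, j) \<in> D \<Longrightarrow> i + j < m"
  shows "c ^ card D \<le> exp c ^ m * real (card (standard_tableaux D))"
proof -
  let ?r = "\<lambda>(i, j). i + j"
  have "level_fillings D ?r \<subseteq> standard_tableaux D"
    unfolding level_fillings_def standard_tableaux_def by (auto simp: Ball_def)
  then have "card (level_fillings D ?r) \<le> card (standard_tableaux D)"
    using assms(1) by (intro card_mono finite_standard_tableaux)
  then have "exp c ^ m * real (card (level_fillings D ?r))
      \<le> exp c ^ m * real (card (standard_tableaux D))"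
    by (intro mult_left_mono) auto
  moreover have "c ^ card D \<le> exp c ^ m * real (card (level_fillings D ?r))"
    using assms by (intro card_level_fillings_ge) auto
  ultimately show ?thesis by linarith
qed

section \<open>Upper bound: a tableau is encoded by the rows of its entries\<close>

text \<open>Listing the values in the order of the arguments gives a sorted list without repetition,
  which is determined by its set. This recovers a row of a tableau from the set of its
  entries.\<close>

lemma strict_mono_on_image_eq_unique:
  fixes f g :: "'a::linorder \<Rightarrow> 'b::linorder"
  assumes "finite A" "strict_mono_on A f" "strict_mono_on A g" "f ` A = g ` A" "x \<in> A"
  shows "f x = g x"
proof -
  let ?xs = "sorted_list_of_set A"
  have "sorted (map h ?xs) \<and> distinct (map h ?xs)" if "strict_mono_on A h" for h :: "'a \<Rightarrow> 'b"
    using that assms(1) strict_mono_on_imp_inj_on[OF that]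
    by (auto simp: distinct_map sorted_wrt_map strict_mono_on_leD
        intro!: sorted_wrt_mono_rel[OF _ sorted_sorted_list_of_set])
  then have "map f ?xs = map g ?xs"
    using assms by (intro sorted_distinct_set_unique) auto
  then show ?thesis
    using assms(1,5) by simp
qed

text \<open>The word \<open>R T\<close> records the row of each entry. It is injective in
  \<open>T\<close>: the positions of the letter \<open>i\<close> are the entries of row
  \<open>i\<close>, and these must appear there in increasing order.\<close>

lemma card_standard_tableaux_le:
  assumes "finite D" "\<And>i j. (i, j) \<in> D \<Longrightarrow> i \<in> {1..k}"
  shows "card (standard_tableaux D) \<le> k ^ card D"
proof -
  let ?N = "card D"
  define R where "R = (\<lambda>T. \<lambda>t\<in>{1..?N}. fst (the_inv_into D T t))"
  have RT: "R T (T x) = fst x" if "T \<in> standard_tableaux D" "x \<in> D" for T x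
  proof -
    have "inj_on T D" "T x \<in> {1..?N}"
      using that by (auto simp: standard_tableaux_def bij_betw_def)
    then show ?thesis using that by (simp add: R_def the_inv_into_f_f)
  qed
  have surj: "\<exists>x\<in>D. t = T x" if "T \<in> standard_tableaux D" "t \<in> {1..?N}" for T t
    using that by (auto simp: standard_tableaux_def bij_betw_def)
  have "card (standard_tableaux D) \<le> card ({1..?N} \<rightarrow>\<^sub>E {1..k})"
  proof (rule card_inj_on_le)
    show "R ` standard_tableaux D \<subseteq> {1..?N} \<rightarrow>\<^sub>E {1..k}"
    proof (rule image_subsetI, rule PiE_I)
      fix T t assume T: "T \<in> standard_tableaux D" and "t \<in> {1..?N}"
      then obtain x where "x \<in> D" "t = T x" using surj by blast
      then show "R T t \<in> {1..k}"
        using assms(2)[of "fst x" "snd x"] T by (simp add: RT)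
    qed (auto simp: R_def)
    show "inj_on R (standard_tableaux D)"
    proof (rule inj_onI)
      fix T T' assume T: "T \<in> standard_tableaux D" "T' \<in> standard_tableaux D" and eq: "R T = R T'"
      have "T x = T' x" for x
      proof (cases "x \<in> D")
        case False
        have "T \<in> extensional D" "T' \<in> extensional D"
          using T unfolding standard_tableaux_def by blast+
        then show ?thesis
          using extensional_arb[OF _ False] by metis
      next
        case True
        obtain i j where x: "x = (i, j)" by fastforce
        \<comment> \<open>The columns met by row \<open>i\<close>; they depend only on
          \<open>D\<close>, so they are common to \<open>T\<close> and \<open>T'\<close>.\<close>
        define C where "C = {j. (i, j) \<in> D}"
        have "C \<subseteq> snd ` D" by (force simp: C_def)
        then have finC: "finite C" using assms(1) by (rule finite_subset[OF _ finite_imageI])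
        have im: "(\<lambda>j. U (i, j)) ` C = {t \<in> {1..?N}. R U t = i}" if U: "U \<in> standard_tableaux D" for U
        proof (intro equalityI subsetI)
          fix t assume "t \<in> (\<lambda>j. U (i, j)) ` C"
          then obtain j where j: "(i, j) \<in> D" "t = U (i, j)" by (auto simp: C_def)
          moreover have "U (i, j) \<in> {1..?N}"
            using U j(1) unfolding standard_tableaux_def by (blast dest: bij_betwE)
          ultimately show "t \<in> {t \<in> {1..?N}. R U t = i}"
            using RT[OF U j(1)] by simp
        next
          fix t assume t: "t \<in> {t \<in> {1..?N}. R U t = i}"
          then obtain y where y: "y \<in> D" "t = U y" using surj[OF U, of t] by blast
          then have "fst y = i" using t RT[OF U, of y] by simp
          with y show "t \<in> (\<lambda>j. U (i, j)) ` C" by (cases y) (simp add: C_def)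
        qed
        have mono: "strict_mono_on C (\<lambda>j. U (i, j))" if "U \<in> standard_tableaux D" for U
          using that unfolding C_def standard_tableaux_def strict_mono_on_def by blast
        have "j \<in> C" using True by (simp add: x C_def)
        moreover have "(\<lambda>j. T (i, j)) ` C = (\<lambda>j. T' (i, j)) ` C"
          using im[OF T(1)] im[OF T(2)] eq by simp
        ultimately show ?thesis
          using strict_mono_on_image_eq_unique[OF finC mono[OF T(1)] mono[OF T(2)]] x by simp
      qed
      then show "T = T'" by auto
    qed
  qed (auto intro: finite_PiE)
  then show ?thesis by (simp add: card_funcsetE)
qed

section \<open>Area as an integral, and its Riemann sums\<close>

text \<open>Tonelli: the vertical slice over \<open>x\<close> is an interval of length
  \<open>g x - f x\<close>.\<close>

lemma measure_between_graphs:
  fixes f g :: "real \<Rightarrow> real"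
  assumes "continuous_on {a..b} f" "continuous_on {a..b} g" "\<And>x. x \<in> {a..b} \<Longrightarrow> f x \<le> g x"
  shows "measure lborel {(x, y). a \<le> x \<and> x \<le> b \<and> f x \<le> y \<and> y \<le> g x} =
    integral {a..b} (\<lambda>x. g x - f x)"
proof -
  \<comment> \<open>Extension by zero makes the functions Borel on the whole line, which the
    measurability of the region requires.\<close>
  define F where "F = (\<lambda>x. indicat_real {a..b} x * f x)"
  define G where "G = (\<lambda>x. indicat_real {a..b} x * g x)"
  define A where "A = {(x, y). a \<le> x \<and> x \<le> b \<and> f x \<le> y \<and> y \<le> g x}"
  have [measurable]: "F \<in> borel_measurable borel" "G \<in> borel_measurable borel"
    using borel_measurable_continuous_on_indicator[OF _ assms(1)]
      borel_measurable_continuous_on_indicator[OF _ assms(2)]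
    by (auto simp: F_def G_def)
  have A: "A = {z \<in> space (lborel \<Otimes>\<^sub>M lborel). a \<le> fst z \<and> fst z \<le> b \<and>
      F (fst z) \<le> snd z \<and> snd z \<le> G (fst z)}"
    by (auto simp: A_def F_def G_def space_pair_measure)
  have meas: "A \<in> sets (lborel \<Otimes>\<^sub>M lborel)"
    unfolding A by measurable
  have int: "((\<lambda>x. g x - f x) has_integral integral {a..b} (\<lambda>x. g x - f x)) {a..b}"
    using assms by (intro integrable_integral integrable_continuous_real continuous_intros)
  have "emeasure lborel A = emeasure (lborel \<Otimes>\<^sub>M lborel) A"
    by (simp add: lborel_prod)
  also have "\<dots> = (\<integral>\<^sup>+ x. emeasure lborel (Pair x -` A) \<partial>lborel)"
    by (rule lborel.emeasure_pair_measure_alt[OF meas])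
  also have "\<dots> = (\<integral>\<^sup>+ x. ennreal (g x - f x) * indicator {a..b} x \<partial>lborel)"
  proof (rule nn_integral_cong)
    fix x
    have "Pair x -` A = (if x \<in> {a..b} then {f x..g x} else {})"
      by (auto simp: A_def)
    then show "emeasure lborel (Pair x -` A) = ennreal (g x - f x) * indicator {a..b} x"
      using assms(3)[of x] by (simp add: indicator_def)
  qed
  also have "\<dots> = ennreal (integral {a..b} (\<lambda>x. g x - f x))"
    using nn_integral_has_integral_lebesgue'[OF _ int] assms(3) by simp
  finally have "measure lborel A = integral {a..b} (\<lambda>x. g x - f x)"
    using integral_nonneg[OF has_integral_integrable[OF int]] assms(3)
    by (simp add: measure_def)
  then show ?thesis by (simp add: A_def)
qed

text \<open>Each strip of width \<open>h\<close> adds an error of at most \<delta> times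
  \<open>h\<close>. The strips are open on the left to match the ceiling in
  \<open>boundary\<close>.\<close>

lemma Riemann_sum_error_le:
  fixes f :: "real \<Rightarrow> real"
  assumes "f integrable_on {0..real M * h}" "0 \<le> h" "0 \<le> \<delta>"
    and "\<And>i x. i \<in> {1..M} \<Longrightarrow> real (i - 1) * h < x \<Longrightarrow> x \<le> real i * h \<Longrightarrow> \<bar>d i - f x\<bar> \<le> \<delta>"
  shows "\<bar>h * (\<Sum>i=1..M. d i) - integral {0..real M * h} f\<bar> \<le> \<delta> * (real M * h)"
  using assms(1,4)
proof (induction M)
  case 0
  then show ?case by simp
next
  case (Suc M)
  define u v where "u = real M * h" and "v = real (Suc M) * h"
  have uv: "0 \<le> u" "u \<le> v" "v - u = h"
    using assms(2) by (auto simp: u_def v_def algebra_simps)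
  have int: "f integrable_on {0..v}" "f integrable_on {0..u}" "f integrable_on {u..v}"
    using uv(1,2) Suc.prems(1)[folded v_def] by (auto intro: integrable_on_subinterval)
  have IH: "\<bar>h * (\<Sum>i=1..M. d i) - integral {0..u} f\<bar> \<le> \<delta> * u"
    unfolding u_def by (intro Suc.IH int[unfolded u_def]) (use Suc.prems(2) in auto)
  have "((\<lambda>x. d (Suc M) - f x) has_integral (h * d (Suc M) - integral {u..v} f)) {u..v}"
    using has_integral_diff[OF has_integral_const_real[of "d (Suc M)" u v]
        integrable_integral[OF int(3)]] uv by simp
  \<comment> \<open>The bound is assumed only to the right of \<open>u\<close>; the point
    \<open>u\<close> itself is the finite exceptional set.\<close>
  then have "norm (h * d (Suc M) - integral {u..v} f) \<le> \<delta> * measure lborel {u..v}"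
    by (rule has_integral_bound_spike_finite[where S = "{u}", unfolded box_real, rotated 2])
      (use assms(3) Suc.prems(2)[of "Suc M"] in \<open>auto simp: u_def v_def\<close>)
  then have "\<bar>h * d (Suc M) - integral {u..v} f\<bar> \<le> \<delta> * h"
    using uv by simp
  moreover have "integral {0..u} f + integral {u..v} f = integral {0..v} f"
    using uv int(1) by (intro Henstock_Kurzweil_Integration.integral_combine) auto
  ultimately show ?case
    using IH uv(3) unfolding v_def[symmetric] by (simp add: algebra_simps abs_le_iff)
qed

section \<open>The number of cells of a skew shape\<close>

lemma part_le_part_1:
  assumes "is_partition p"
  shows "part p i \<le> part p 1"
proof (cases "2 \<le> i \<and> i \<le> length p")
  case True
  then show ?thesis
    using assms sorted_wrt_nth_less[of "(\<ge>)" p 0 "i - 1"]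
    by (auto simp: is_partition_def part_def)
next
  case False
  then have "i = 1 \<or> part p i = 0"
    by (auto simp: part_def)
  then show ?thesis by auto
qed

lemma skew_diagram_eq_Sigma:
  "skew_diagram p q = Sigma {1..length p} (\<lambda>i. {part q i<..part p i})"
  by (auto simp: skew_diagram_def part_def split: if_splits)

lemma finite_skew_diagram: "finite (skew_diagram p q)"
  by (simp add: skew_diagram_eq_Sigma)

lemma card_skew_diagram: "card (skew_diagram p q) = (\<Sum>i=1..length p. part p i - part q i)"
  by (simp add: skew_diagram_eq_Sigma)

text \<open>On the i-th half-open strip the ceiling is exactly \<open>i\<close>. There
  \<open>x\<close> is positive, so the special value of \<open>boundary\<close> at 0 does not
  interfere.\<close>

lemma rescaled_eq_part:
  assumes "0 < n" "1 \<le> i" "real (i - 1) / sqrt n < x" "x \<le> real i / sqrt n"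
  shows "rescaled n p x = real (part p i) / sqrt n"
proof -
  have "real (i - 1) < x * sqrt n" "x * sqrt n \<le> real i"
    using assms by (auto simp: field_simps)
  then have "\<lceil>x * sqrt n\<rceil> = int i"
    using assms(2) by (intro ceiling_unique) (auto simp: of_nat_diff)
  moreover have "0 < x"
    using assms(3) by (rule order.strict_trans1[rotated]) simp
  ultimately show ?thesis
    using assms(1) by (simp add: rescaled_def boundary_def)
qed

text \<open>Three errors add up. The full strips inside \<open>{0..a}\<close> give the first term,
  with one \<delta> for each boundary curve; the incomplete last strip gives
  \<open>b / sqrt n\<close>; the rows beyond these strips, at most
  \<open>\<epsilon> * sqrt n + 1\<close> many with at most \<open>c * sqrt n\<close> cells each,
  give the last term after division by \<open>n\<close>.\<close>

lemma abs_card_skew_diagram_div_minus_integral_le: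
  fixes \<omega> \<pi> :: "real \<Rightarrow> real"
  assumes "is_skew_shape p q" "0 < n" "0 \<le> a" "0 \<le> \<epsilon>" "0 \<le> \<delta>" "0 \<le> b"
    and int: "(\<lambda>x. \<omega> x - \<pi> x) integrable_on {0..a}"
    and f: "\<And>x. x \<in> {0..a} \<Longrightarrow> 0 \<le> \<omega> x - \<pi> x \<and> \<omega> x - \<pi> x \<le> b"
    and p: "\<And>x. x \<in> {0..a} \<Longrightarrow> \<bar>rescaled n p x - \<omega> x\<bar> \<le> \<delta>"
    and q: "\<And>x. x \<in> {0..a} \<Longrightarrow> \<bar>rescaled n q x - \<pi> x\<bar> \<le> \<delta>"
    and len: "real (length p) \<le> (a + \<epsilon>) * sqrt n"
    and part_1: "real (part p 1) \<le> c * sqrt n"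
  shows "\<bar>real (card (skew_diagram p q)) / n - integral {0..a} (\<lambda>x. \<omega> x - \<pi> x)\<bar>
    \<le> 2 * \<delta> * a + b / sqrt n + c * (\<epsilon> + 1 / sqrt n)"
proof -
  define f where "f = (\<lambda>x. \<omega> x - \<pi> x)"
  define h where "h = 1 / sqrt n"
  \<comment> \<open>The number of full strips of width \<open>h\<close> in \<open>{0..a}\<close>. It
    may be smaller or larger than \<open>length p\<close>.\<close>
  define M where "M = nat \<lfloor>a * sqrt n\<rfloor>"
  define d where "d = (\<lambda>i. part p i - part q i)"
  define S where "S = (\<lambda>k. \<Sum>i=1..k. d i)"
  have h: "0 < h" "h * sqrt n = 1" "h * h = 1 / n"
    using assms(2) by (auto simp: h_def)
  have part_q: "part q i \<le> part p i" for i
    using assms(1) by (simp add: is_skew_shape_def)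
  have M: "real M \<le> a * sqrt n" "a * sqrt n < real M + 1"
    using assms(2,3) by (auto simp: M_def)
  have "a = a * sqrt n * h"
    using h(2) by (simp add: mult.commute)
  moreover have "(real M + 1) * h = real M * h + h"
    by (simp add: algebra_simps)
  moreover define u where "u = real M * h"
  ultimately have u: "0 \<le> u" "u \<le> a" "a - u \<le> h"
    using mult_right_mono[OF M(1), of h] mult_right_mono[OF less_imp_le[OF M(2)], of h] h(1)
      mult_nonneg_nonneg[OF of_nat_0_le_iff, of h M]
    by linarith+
  have S_le: "S M \<le> S (length p)"
  proof -
    \<comment> \<open>Beyond \<open>length p\<close> the summand \<open>d i\<close> vanishes,
      because \<open>part p i\<close> is 0 and subtraction on naturals truncates.\<close>
    have "S M = (\<Sum>i\<in>{1..M} \<inter> {1..length p}. d i)"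
      unfolding S_def by (intro sum.mono_neutral_right) (auto simp: d_def part_def)
    also have "\<dots> \<le> S (length p)"
      unfolding S_def by (intro sum_mono2) auto
    finally show ?thesis .
  qed
  have S_diff: "real (S (length p)) - real (S M) \<le> (\<epsilon> * sqrt n + 1) * (c * sqrt n)"
  proof (cases "length p \<le> M")
    case True
    then have "S (length p) \<le> S M"
      unfolding S_def by (intro sum_mono2) auto
    moreover have "0 \<le> (\<epsilon> * sqrt n + 1) * (c * sqrt n)"
      using assms(4)
      by (intro mult_nonneg_nonneg[OF _ order_trans[OF of_nat_0_le_iff part_1]]) simp
    ultimately show ?thesis by linarith
  next
    case False
    have "S (length p) = S M + (\<Sum>i\<in>{M<..length p}. d i)"
    proof -
      have "{1..length p} = {1..M} \<union> {M<..length p}" using False by auto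
      then show ?thesis
        unfolding S_def by (simp add: sum.union_disjoint disjoint_iff)
    qed
    also have "(\<Sum>i\<in>{M<..length p}. d i) \<le> of_nat (card {M<..length p}) * part p 1"
      using assms(1) part_le_part_1
      by (intro sum_bounded_above)
        (auto simp: d_def is_skew_shape_def intro: order_trans[OF diff_le_self])
    finally have "S (length p) \<le> S M + (length p - M) * part p 1"
      by simp
    then have "real (S (length p)) \<le> real (S M + (length p - M) * part p 1)"
      by (rule of_nat_mono)
    also have "\<dots> = real (S M) + (real (length p) - real M) * real (part p 1)"
      using False by (simp add: of_nat_diff)
    finally have "real (S (length p)) - real (S M) \<le> (real (length p) - real M) * real (part p 1)"
      by simp
    also have "\<dots> \<le> (\<epsilon> * sqrt n + 1) * (c * sqrt n)"
    proof (rule mult_mono)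
      show "real (length p) - real M \<le> \<epsilon> * sqrt n + 1"
        using len M by (simp add: algebra_simps)
    qed (use assms(4) part_1 in auto)
    finally show ?thesis .
  qed
  have tail: "\<bar>real (S (length p)) / n - real (S M) / n\<bar> \<le> c * (\<epsilon> + h)"
  proof -
    have "(\<epsilon> * sqrt n + 1) * (c * sqrt n) = n * (c * (\<epsilon> + h))"
      using assms(2) by (simp add: h_def field_simps)
    with S_diff have "real (S (length p)) - real (S M) \<le> n * (c * (\<epsilon> + h))"
      by simp
    then have "real (S (length p)) / n - real (S M) / n \<le> c * (\<epsilon> + h)"
      using assms(2) by (simp only: pos_divide_le_eq of_nat_0_less_iff mult.commute
          flip: diff_divide_distrib)
    moreover have "real (S M) / n \<le> real (S (length p)) / n"
      using S_le by (simp add: divide_right_mono)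
    ultimately show ?thesis by simp
  qed
  have int_M: "f integrable_on {0..u}" "f integrable_on {u..a}"
    using int u unfolding f_def by (auto intro: integrable_on_subinterval)
  \<comment> \<open>One factor \<open>h\<close> is the width of a strip, the other rescales the row
    length; their product \<open>1 / n\<close> later turns the sum into
    \<open>S M / n\<close>.\<close>
  have "\<bar>h * (\<Sum>i=1..M. real (d i) * h) - integral {0..u} f\<bar> \<le> (2 * \<delta>) * u"
    unfolding u_def
  proof (rule Riemann_sum_error_le)
    fix i x
    assume i: "i \<in> {1..M}" and x: "real (i - 1) * h < x" "x \<le> real i * h"
    have "0 \<le> real (i - 1) * h" "real i * h \<le> u"
      using i h by (auto simp: u_def intro: mult_right_mono)
    then have "x \<in> {0..a}" using x u unfolding atLeastAtMost_iff by linarith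
    moreover have "rescaled n p x = real (part p i) * h" "rescaled n q x = real (part q i) * h"
      using rescaled_eq_part[of n i x] i x assms(2) by (auto simp: h_def)
    moreover have "real (d i) * h = real (part p i) * h - real (part q i) * h"
      using part_q[of i] by (simp add: d_def of_nat_diff algebra_simps)
    ultimately show "\<bar>real (d i) * h - f x\<bar> \<le> 2 * \<delta>"
      using p[of x] q[of x] by (simp add: f_def)
  qed (use int_M h assms(5) in \<open>auto simp: u_def\<close>)
  also have "\<dots> \<le> 2 * \<delta> * a"
    using u assms(5) by (intro mult_left_mono) auto
  also have "h * (\<Sum>i=1..M. real (d i) * h) = real (S M) / n"
  proof -
    have "h * (\<Sum>i=1..M. real (d i) * h) = real (S M) * (h * h)"
      unfolding sum_distrib_right[symmetric] S_def of_nat_sum by (simp only: mult_ac)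
    then show ?thesis by (simp add: h(3))
  qed
  finally have head: "\<bar>real (S M) / n - integral {0..u} f\<bar> \<le> 2 * \<delta> * a" .
  have "integral {0..u} f + integral {u..a} f = integral {0..a} f"
    using int u unfolding f_def by (intro Henstock_Kurzweil_Integration.integral_combine) auto
  moreover have "\<bar>integral {u..a} f\<bar> \<le> b * h"
  proof -
    have "norm (integral {u..a} f) \<le> b * (a - u)"
    proof (rule has_integral_bound_real[THEN order_trans])
      show "(f has_integral integral {u..a} f) {u..a}"
        using int_M(2) by (rule integrable_integral)
      show "norm (f x) \<le> b" if "x \<in> {u..a} - {}" for x
        using that u f[of x] by (auto simp: f_def)
    qed (use u assms(6) in auto)
    also have "\<dots> \<le> b * h"
      using u assms(6) by (intro mult_left_mono)
    finally show ?thesis by simp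
  qed
  ultimately have "\<bar>real (S (length p)) / n - integral {0..a} f\<bar> \<le> 2 * \<delta> * a + b * h + c * (\<epsilon> + h)"
    using head tail by linarith
  then show ?thesis
    by (simp add: card_skew_diagram S_def d_def f_def h_def)
qed

section \<open>Logarithms of the two bounds, and the limit\<close>

text \<open>The lower bound takes \<open>sqrt n\<close> as the free base and
  \<open>m = length p + part p 1 + 1\<close>, which exceeds every \<open>i + j\<close>; the loss
  \<open>m * sqrt n\<close> is then at most \<open>c * n\<close>. The upper bound takes
  \<open>length p\<close> as the number of rows.\<close>

lemma ln_num_SYT_bounds:
  fixes c n :: real
  assumes "is_skew_shape p q" "0 < n" "1 \<le> c"
    and len: "real (length p + part p 1 + 1) \<le> c * sqrt n"
  defines "N \<equiv> card (skew_diagram p q)"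
  shows "real N * (ln n / 2) - c * n \<le> ln (num_SYT p q)"
    and "ln (num_SYT p q) \<le> real N * (ln n / 2 + ln c)"
proof -
  define m where "m = length p + part p 1 + 1"
  have rank: "i + j < m" if "(i, j) \<in> skew_diagram p q" for i j
    using that assms(1) part_le_part_1[of p i]
    by (auto simp: skew_diagram_eq_Sigma is_skew_shape_def m_def)
  have sqrt: "0 < sqrt n" "sqrt n * sqrt n = n" "ln (sqrt n) = ln n / 2"
    using assms(2) by (auto simp: ln_sqrt)
  have ge: "sqrt n ^ N \<le> exp (sqrt n) ^ m * real (num_SYT p q)"
    unfolding N_def num_SYT_def
    using rank by (intro card_standard_tableaux_ge finite_skew_diagram sqrt(1))
  \<comment> \<open>The lower bound already forces a tableau to exist, so the logarithms below can
    be split and compared.\<close>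
  have pos: "0 < real (num_SYT p q)"
  proof (rule ccontr)
    assume "\<not> ?thesis"
    with ge have "sqrt n ^ N \<le> 0" by simp
    then show False using zero_less_power[OF sqrt(1), of N] by linarith
  qed
  have "real N * (ln n / 2) = ln (sqrt n ^ N)"
    using sqrt by (simp add: ln_realpow)
  also have "\<dots> \<le> ln (exp (sqrt n) ^ m * real (num_SYT p q))"
    using ge sqrt(1) pos by (subst ln_le_cancel_iff) auto
  also have "\<dots> = real m * sqrt n + ln (num_SYT p q)"
    using pos by (simp add: ln_mult ln_realpow)
  also have "real m * sqrt n \<le> c * n"
    using mult_right_mono[OF len, of "sqrt n"] sqrt by (simp add: m_def mult.assoc)
  finally show "real N * (ln n / 2) - c * n \<le> ln (num_SYT p q)" by simp
  have "num_SYT p q \<le> length p ^ N"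
    unfolding N_def num_SYT_def
    by (intro card_standard_tableaux_le finite_skew_diagram) (auto simp: skew_diagram_eq_Sigma)
  then have "real (num_SYT p q) \<le> real (length p) ^ N"
    by (simp flip: of_nat_power)
  also have "\<dots> \<le> (c * sqrt n) ^ N"
    using len by (intro power_mono) auto
  finally have "ln (num_SYT p q) \<le> ln ((c * sqrt n) ^ N)"
    using pos by (intro ln_mono) auto
  also have "\<dots> = real N * (ln n / 2 + ln c)"
    using assms(2,3) sqrt by (simp add: ln_realpow ln_mult algebra_simps)
  finally show "ln (num_SYT p q) \<le> real N * (ln n / 2 + ln c)" .
qed

theorem theorem6p1:
  fixes a b :: real
    and \<omega> \<pi> :: "real \<Rightarrow> real"
    and lam mu :: "nat \<Rightarrow> nat list"
  assumes "continuous_on {0..a} \<omega>" and "continuous_on {0..a} \<pi>"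
    and "antimono_on {0..a} \<omega>" and "antimono_on {0..a} \<pi>"
    and "\<omega> ` {0..a} \<subseteq> {0..b}" and "\<pi> ` {0..a} \<subseteq> {0..b}"
    and "\<forall>x\<in>{0..a}. \<pi> x \<le> \<omega> x"
    and "skew_area a \<omega> \<pi> = 1"
    and "\<And>n. connected_skew_shape (lam n) (mu n)"
    and "stable_shape a lam \<omega>" and "stable_shape a mu \<pi>"
  shows "(\<lambda>n. ln (real (num_SYT (lam n) (mu n)))) \<sim>[sequentially]
           (\<lambda>n. 1 / 2 * real n * ln (real n))"
proof -
  define N where "N = (\<lambda>n. real (card (skew_diagram (lam n) (mu n))))"
  \<comment> \<open>In units of \<open>sqrt n\<close>: \<open>a + 1\<close> bounds the number of
    rows, \<open>b + 1\<close> the first row, and the remaining 2 absorbs the summand 1.\<close>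
  define C where "C = a + b + 4"
  have int: "integral {0..a} (\<lambda>x. \<omega> x - \<pi> x) = 1"
    using assms(8) measure_between_graphs[OF assms(2,1)] assms(7) by (simp add: skew_area_def)
  \<comment> \<open>Otherwise the integral is over the empty set or a single point and vanishes, but
    the area is 1.\<close>
  have a: "0 < a"
  proof (rule ccontr)
    assume "\<not> 0 < a"
    then have "{0..a} = {} \<or> {0..a} = {0}" by auto
    then show False using int by auto
  qed
  have b: "0 \<le> b" using assms(5) a by fastforce
  have skew: "is_skew_shape (lam n) (mu n)" for n
    using assms(9) by (simp add: connected_skew_shape_def)
  have unif: "uniform_limit {0..a} (\<lambda>n. rescaled n (lam n)) \<omega> sequentially"
    "uniform_limit {0..a} (\<lambda>n. rescaled n (mu n)) \<pi> sequentially"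
    using assms(10,11) by (auto simp: stable_shape_def)
  have close: "\<forall>\<^sub>F n in sequentially. \<forall>x\<in>{0..a}.
      \<bar>rescaled n (lam n) x - \<omega> x\<bar> \<le> \<delta> \<and> \<bar>rescaled n (mu n) x - \<pi> x\<bar> \<le> \<delta>"
    if "0 < \<delta>" for \<delta>
    using uniform_limitD[OF unif(1) that] uniform_limitD[OF unif(2) that]
    by eventually_elim (force simp: dist_real_def)
  obtain \<epsilon>' where \<epsilon>': "\<epsilon>' \<longlonglongrightarrow> 0"
    "\<forall>\<^sub>F n in sequentially. real (length (lam n)) \<le> (a + \<epsilon>' n) * sqrt n"
    using assms(10) by (auto simp: stable_shape_def)
  \<comment> \<open>The given error may be negative, while the cell count estimate wants a
    nonnegative one.\<close>
  define \<epsilon> where "\<epsilon> = (\<lambda>n. \<bar>\<epsilon>' n\<bar>)"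
  have \<epsilon>: "\<epsilon> \<longlonglongrightarrow> 0"
    using \<epsilon>'(1) unfolding \<epsilon>_def by (rule tendsto_rabs_zero)
  have len: "\<forall>\<^sub>F n in sequentially. real (length (lam n)) \<le> (a + \<epsilon> n) * sqrt n"
    using \<epsilon>'(2)
  proof eventually_elim
    case (elim n)
    then show ?case
      by (rule order_trans) (auto simp: \<epsilon>_def intro!: mult_right_mono)
  qed
  \<comment> \<open>Uniform convergence with tolerance 1, evaluated at 0, where
    \<open>boundary\<close> is the first part.\<close>
  have part_1: "\<forall>\<^sub>F n in sequentially. real (part (lam n) 1) \<le> (b + 1) * sqrt n"
    using close[of 1, simplified] eventually_gt_at_top[of 0]
  proof eventually_elim
    case (elim n)
    have "\<omega> 0 \<in> {0..b}" using assms(5) a by (simp add: image_subset_iff)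
    moreover have "\<bar>rescaled n (lam n) 0 - \<omega> 0\<bar> \<le> 1" using elim(1) a by auto
    ultimately have "rescaled n (lam n) 0 \<le> b + 1" by auto
    then show ?case
      using elim(2) by (simp add: rescaled_def boundary_def field_simps)
  qed
  have inv_sqrt: "(\<lambda>n. 1 / sqrt (real n)) \<longlonglongrightarrow> 0"
    by real_asymp
  have inv_ln: "(\<lambda>n. 1 / ln (real n)) \<longlonglongrightarrow> 0"
    by real_asymp
  have N: "(\<lambda>n. N n / real n) \<longlonglongrightarrow> 1"
  proof (rule tendstoI)
    fix e :: real assume e: "0 < e"
    \<comment> \<open>With this choice the term \<open>2 * \<delta> * a\<close> equals
      \<open>e / 2\<close>; the other terms of \<open>E\<close> tend to 0.\<close>
    define \<delta> where "\<delta> = e / (4 * a)"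
    have \<delta>: "0 < \<delta>" using e a by (simp add: \<delta>_def)
    define E where "E = (\<lambda>n. 2 * \<delta> * a + b / sqrt n + (b + 1) * (\<epsilon> n + 1 / sqrt n))"
    have "E \<longlonglongrightarrow> 2 * \<delta> * a + b * 0 + (b + 1) * (0 + 0)"
      unfolding E_def using tendsto_mult_left[OF inv_sqrt, of b]
      by (intro tendsto_intros inv_sqrt \<epsilon>) simp
    moreover have "2 * \<delta> * a + b * 0 + (b + 1) * (0 + 0) < e"
      using a e by (simp add: \<delta>_def)
    ultimately have "\<forall>\<^sub>F n in sequentially. E n < e"
      by (rule order_tendstoD)
    moreover have "\<forall>\<^sub>F n in sequentially. \<bar>N n / n - 1\<bar> \<le> E n"
      using close[OF \<delta>] len part_1 eventually_gt_at_top[of 0]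
    proof eventually_elim
      case (elim n)
      have "\<bar>N n / n - integral {0..a} (\<lambda>x. \<omega> x - \<pi> x)\<bar> \<le> E n"
        unfolding N_def E_def
      proof (rule abs_card_skew_diagram_div_minus_integral_le[OF skew])
        show "(\<lambda>x. \<omega> x - \<pi> x) integrable_on {0..a}"
          using assms(1,2) by (intro integrable_continuous_real continuous_intros)
        show "0 \<le> \<omega> x - \<pi> x \<and> \<omega> x - \<pi> x \<le> b" if "x \<in> {0..a}" for x
        proof -
          have "\<omega> x \<in> {0..b}" "\<pi> x \<in> {0..b}" using assms(5,6) that by blast+
          then show ?thesis using assms(7) that by auto
        qed
      qed (use elim a b \<delta> in \<open>auto simp: \<epsilon>_def\<close>)
      then show ?case by (simp add: int)
    qed
    ultimately show "\<forall>\<^sub>F n in sequentially. dist (N n / n) 1 < e"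
      by eventually_elim (simp add: dist_real_def)
  qed
  have size: "\<forall>\<^sub>F n in sequentially. real (length (lam n) + part (lam n) 1 + 1) \<le> C * sqrt n"
  proof -
    have "\<forall>\<^sub>F n in sequentially. \<epsilon> n < 1"
      using \<epsilon> by (rule order_tendstoD) simp
    then show ?thesis
      using len part_1 eventually_ge_at_top[of 1]
    proof eventually_elim
      case (elim n)
      have "(a + \<epsilon> n) * sqrt n \<le> (a + 1) * sqrt n"
        using elim(1) by (intro mult_right_mono) auto
      moreover have "1 \<le> sqrt n" using elim(4) by simp
      moreover have "C * sqrt n = (a + 1) * sqrt n + (b + 1) * sqrt n + 2 * sqrt n"
        by (simp add: C_def algebra_simps)
      ultimately show ?case
        using elim(2,3) unfolding of_nat_add of_nat_1 by linarith
    qed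
  qed
  have "1 \<le> C" using a b by (simp add: C_def)
  \<comment> \<open>Both bounds divided by \<open>1 / 2 * n * ln n\<close>, which is positive for
    \<open>n > 1\<close>. The linear terms turn into multiples of \<open>1 / ln n\<close>, so
    \<open>N n / n\<close> alone decides the limit.\<close>
  have bounds: "\<forall>\<^sub>F n in sequentially.
      N n / n - 2 * C * (1 / ln n) \<le> ln (num_SYT (lam n) (mu n)) / (1 / 2 * n * ln n) \<and>
      ln (num_SYT (lam n) (mu n)) / (1 / 2 * n * ln n) \<le> N n / n * (1 + 2 * ln C * (1 / ln n))"
    using size eventually_gt_at_top[of 1]
  proof eventually_elim
    case (elim n)
    define l where "l = ln (real n)"
    have l: "0 < l" using elim(2) by (simp add: l_def)
    have n: "0 < real n" using elim(2) by simp
    note * = ln_num_SYT_bounds[OF skew _ \<open>1 \<le> C\<close> elim(1), folded l_def]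
    have "N n / n - 2 * C * (1 / l) = (N n * (l / 2) - C * n) / (1 / 2 * n * l)"
      using n l by (simp add: field_simps)
    also have "\<dots> \<le> ln (num_SYT (lam n) (mu n)) / (1 / 2 * n * l)"
      using * n l by (intro divide_right_mono) (auto simp: N_def)
    finally have 1: "N n / n - 2 * C * (1 / l) \<le> ln (num_SYT (lam n) (mu n)) / (1 / 2 * n * l)" .
    have "ln (num_SYT (lam n) (mu n)) / (1 / 2 * n * l) \<le> N n * (l / 2 + ln C) / (1 / 2 * n * l)"
      using * n l by (intro divide_right_mono) (auto simp: N_def)
    also have "\<dots> = N n / n * (1 + 2 * ln C * (1 / l))"
      using n l by (simp add: field_simps)
    finally show ?case using 1 by (simp add: l_def)
  qed
  show ?thesis
  proof (rule asymp_equivI', rule tendsto_sandwich)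
    have "(\<lambda>n. N n / n - 2 * C * (1 / ln n)) \<longlonglongrightarrow> 1 - 2 * C * 0"
      by (intro tendsto_intros N inv_ln)
    then show "(\<lambda>n. N n / n - 2 * C * (1 / ln n)) \<longlonglongrightarrow> 1" by simp
    have "(\<lambda>n. N n / n * (1 + 2 * ln C * (1 / ln n))) \<longlonglongrightarrow> 1 * (1 + 2 * ln C * 0)"
      by (intro tendsto_intros N inv_ln)
    then show "(\<lambda>n. N n / n * (1 + 2 * ln C * (1 / ln n))) \<longlonglongrightarrow> 1" by simp
  qed (use bounds in \<open>auto elim: eventually_mono\<close>)
qed

end
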